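(* Let $n\ge 0$ be an integer and let $F_n$ be the weighted tree with vertices $E_0,E_1,\dots,E_n$ and six further vertices $F_1,\dots,F_6$, where $E_0$ has weight $3$, all other vertices have weight $2$, and the edges are those of the chain $E_n - E_{n-1} - \cdots - E_1 - E_0 - F_1 - F_2 - F_3 - F_4 - F_5$ together with one edge joining the vertices $F_6$ and $F_3$. Then the number of elements of the triple root system $R(F_n)$ of this tree is $n^2+55n+126$.
   Context: For a finite weighted tree $\Gamma$ with vertices $V_i$ of weights $w_i$, the intersection form on $\bigoplus_i\mathbb{Z}V_i$ is the symmetric bilinear form with $(V_i\cdot V_i)=-w_i$ and, for $i\neq j$, $(V_i\cdot V_j)=1$ if $V_i$ and $V_j$ are joined by an edge and $0$ otherwise. A non-zero element $\sum m_iV_i$ is a positive (resp. negative) divisor if all $m_i\ge 0$ (resp. all $m_i\le 0$). The triple root system $R(\Gamma)$ is the set of all positive and negative divisors $Y$ with $(Y\cdot Y)=-2$ or $(Y\cdot Y)=-3$. *)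

theory Defs
  imports Main
begin

record 'a weighted_graph =
  verts :: "'a set"
  edges :: "'a set set"
  weight :: "'a \<Rightarrow> int"

definition is_cycle :: "('a, 'b) weighted_graph_scheme \<Rightarrow> 'a list \<Rightarrow> bool" where
  "is_cycle G xs \<longleftrightarrow> length xs \<ge> 3 \<and> distinct xs \<and>
     (\<forall>i < length xs. {xs ! i, xs ! (Suc i mod length xs)} \<in> edges G)"

definition finite_weighted_tree :: "('a, 'b) weighted_graph_scheme \<Rightarrow> bool" where
  "finite_weighted_tree G \<longleftrightarrow>
     finite (verts G) \<and> verts G \<noteq> {} \<and>
     (\<forall>e \<in> edges G. e \<subseteq> verts G \<and> card e = 2) \<and>
     (\<forall>u \<in> verts G. \<forall>v \<in> verts G. (u, v) \<in> {(x, y). {x, y} \<in> edges G}\<^sup>*) \<and>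
     (\<nexists>xs. is_cycle G xs)"

text \<open>The free abelian group on the (finite) vertex set: an element is identified with its
  coefficient function, extended by zero off the vertex set.\<close>

definition vertex_lattice :: "('a, 'b) weighted_graph_scheme \<Rightarrow> ('a \<Rightarrow> int) set" where
  "vertex_lattice G = {Y. \<forall>v. v \<notin> verts G \<longrightarrow> Y v = 0}"

definition vertex_intersection :: "('a, 'b) weighted_graph_scheme \<Rightarrow> 'a \<Rightarrow> 'a \<Rightarrow> int" where
  "vertex_intersection G u v =
     (if u = v then - weight G u else if {u, v} \<in> edges G then 1 else 0)"

definition intersection_form ::
    "('a, 'b) weighted_graph_scheme \<Rightarrow> ('a \<Rightarrow> int) \<Rightarrow> ('a \<Rightarrow> int) \<Rightarrow> int" where
  "intersection_form G Y Z =
     (\<Sum>u \<in> verts G. \<Sum>v \<in> verts G. Y u * Z v * vertex_intersection G u v)"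

definition positive_divisor :: "('a, 'b) weighted_graph_scheme \<Rightarrow> ('a \<Rightarrow> int) \<Rightarrow> bool" where
  "positive_divisor G Y \<longleftrightarrow>
     Y \<in> vertex_lattice G \<and> Y \<noteq> (\<lambda>_. 0) \<and> (\<forall>v \<in> verts G. Y v \<ge> 0)"

definition negative_divisor :: "('a, 'b) weighted_graph_scheme \<Rightarrow> ('a \<Rightarrow> int) \<Rightarrow> bool" where
  "negative_divisor G Y \<longleftrightarrow>
     Y \<in> vertex_lattice G \<and> Y \<noteq> (\<lambda>_. 0) \<and> (\<forall>v \<in> verts G. Y v \<le> 0)"

definition triple_root_system :: "('a, 'b) weighted_graph_scheme \<Rightarrow> ('a \<Rightarrow> int) set" where
  "triple_root_system G =
     {Y. (positive_divisor G Y \<or> negative_divisor G Y) \<and>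
         (intersection_form G Y Y = -2 \<or> intersection_form G Y Y = -3)}"

datatype vertex = E nat | F nat

definition F_tree :: "nat \<Rightarrow> vertex weighted_graph" where
  "F_tree n = \<lparr>
     verts = E ` {0..n} \<union> F ` {1..6},
     edges = {{E i, E (Suc i)} | i. i < n} \<union> {{E 0, F 1}} \<union>
             {{F 1, F 2}, {F 2, F 3}, {F 3, F 4}, {F 4, F 5}} \<union> {{F 6, F 3}},
     weight = (\<lambda>v. if v = E 0 then 3 else 2)\<rparr>"

lemma no_cycle_if_parent:
  fixes r :: "'a \<Rightarrow> nat" and p :: "'a \<Rightarrow> 'a"
  assumes par: "\<And>x y. {x, y} \<in> edges G \<Longrightarrow> r y < r x \<and> y = p x \<or> r x < r y \<and> x = p y"
  shows "\<not> is_cycle G xs"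
proof
  assume c: "is_cycle G xs"
  define l where "l = length xs"
  have l: "l \<ge> 3" and d: "distinct xs"
    and ed: "\<And>i. i < l \<Longrightarrow> {xs ! i, xs ! (Suc i mod l)} \<in> edges G"
    using c by (auto simp: is_cycle_def l_def)
  define M where "M = Max ((\<lambda>i. r (xs ! i)) ` {..<l})"
  have "M \<in> (\<lambda>i. r (xs ! i)) ` {..<l}"
    unfolding M_def using l by (intro Max_in) (auto simp: lessThan_empty_iff)
  then obtain i where i: "i < l" "r (xs ! i) = M" by auto
  have le: "r (xs ! j) \<le> M" if "j < l" for j
    unfolding M_def using that by (intro Max_ge) auto
  define j where "j = Suc i mod l"
  define k where "k = (if i = 0 then l - 1 else i - 1)"
  have jl: "j < l" and kl: "k < l" using l i by (auto simp: j_def k_def)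
  have ki: "Suc k mod l = i" using l i by (auto simp: k_def)
  have "j \<noteq> k"
    using l i by (cases "Suc i = l") (auto simp: j_def k_def)
  moreover have "xs ! j = p (xs ! i)"
    using par[OF ed[OF i(1)]] le[OF jl] i(2) by (auto simp: j_def)
  moreover have "xs ! k = p (xs ! i)"
    using par[OF ed[OF kl]] le[OF kl] i(2) by (auto simp: ki)
  ultimately show False
    using d jl kl by (metis l_def nth_eq_iff_index_eq)
qed

lemma finite_weighted_tree_F_tree: "finite_weighted_tree (F_tree n)"
proof -
  let ?G = "F_tree n"
  let ?A = "{(x, y). {x, y} \<in> edges ?G}"
  have fin: "finite (verts ?G)" "verts ?G \<noteq> {}"
    by (auto simp: F_tree_def)
  have two: "\<forall>e \<in> edges ?G. e \<subseteq> verts ?G \<and> card e = 2"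
    by (auto simp: F_tree_def)
  have sym: "sym (?A\<^sup>*)"
    by (rule sym_rtrancl) (simp add: sym_def insert_commute)
  have Ereach: "(E 0, E i) \<in> ?A\<^sup>*" if "i \<le> n" for i
    using that
  proof (induction i)
    case (Suc i)
    have "i < n" using Suc.prems by simp
    then have "{E i, E (Suc i)} \<in> {{E i, E (Suc i)} | i. i < n}" by blast
    then have "{E i, E (Suc i)} \<in> edges ?G"
      unfolding F_tree_def weighted_graph.select_convs by (intro UnI1)
    then have step: "(E i, E (Suc i)) \<in> ?A" by simp
    have "(E 0, E i) \<in> ?A\<^sup>*" using Suc by simp
    then show ?case using step by (rule rtrancl_into_rtrancl)
  qed (rule rtrancl_refl)
  have st: "(E 0, F 1) \<in> ?A" "(F 1, F 2) \<in> ?A" "(F 2, F 3) \<in> ?A" "(F 3, F 4) \<in> ?A"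
      "(F 4, F 5) \<in> ?A" "(F 3, F 6) \<in> ?A"
    unfolding F_tree_def by (simp_all add: insert_commute)
  have f1: "(E 0, F 1) \<in> ?A\<^sup>*" using st(1) by (rule r_into_rtrancl)
  have f2: "(E 0, F 2) \<in> ?A\<^sup>*" using f1 st(2) by (rule rtrancl_into_rtrancl)
  have f3: "(E 0, F 3) \<in> ?A\<^sup>*" using f2 st(3) by (rule rtrancl_into_rtrancl)
  have f4: "(E 0, F 4) \<in> ?A\<^sup>*" using f3 st(4) by (rule rtrancl_into_rtrancl)
  have f5: "(E 0, F 5) \<in> ?A\<^sup>*" using f4 st(5) by (rule rtrancl_into_rtrancl)
  have f6: "(E 0, F 6) \<in> ?A\<^sup>*" using f3 st(6) by (rule rtrancl_into_rtrancl)
  have reach: "(E 0, v) \<in> ?A\<^sup>*" if v: "v \<in> verts ?G" for v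
  proof -
    have six: "{1..6::nat} = {1, 2, 3, 4, 5, 6}" by auto
    have "(\<exists>i \<le> n. v = E i) \<or> v = F 1 \<or> v = F 2 \<or> v = F 3 \<or> v = F 4 \<or> v = F 5 \<or> v = F 6"
      using v unfolding F_tree_def six by auto
    then show ?thesis
      using Ereach f1 f2 f3 f4 f5 f6 by (elim disjE exE conjE) (simp_all only:)
  qed
  have conn: "\<forall>u \<in> verts ?G. \<forall>v \<in> verts ?G. (u, v) \<in> ?A\<^sup>*"
  proof (intro ballI)
    fix u v assume "u \<in> verts ?G" "v \<in> verts ?G"
    then have "(u, E 0) \<in> ?A\<^sup>*" "(E 0, v) \<in> ?A\<^sup>*"
      using symD[OF sym reach] reach by blast+
    then show "(u, v) \<in> ?A\<^sup>*" by (rule rtrancl_trans)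
  qed
  define r where "r = (\<lambda>x. case x of E i \<Rightarrow> i | F i \<Rightarrow> i)"
  define p where "p = (\<lambda>x. case x of E i \<Rightarrow> E (i - 1) |
    F i \<Rightarrow> if i = 1 then E 0 else if i = 6 then F 3 else F (i - 1))"
  have "r y < r x \<and> y = p x \<or> r x < r y \<and> x = p y" if "{x, y} \<in> edges ?G" for x y
    using that by (auto simp: F_tree_def r_def p_def doubleton_eq_iff)
  then have "\<nexists>xs. is_cycle ?G xs"
    using no_cycle_if_parent[of ?G r p] by blast
  with fin two conn show ?thesis unfolding finite_weighted_tree_def by blast
qed

end

theory Submission
  imports Defs
begin

text \<open>
  Write a divisor as \<open>Y = \<Sum> e\<^sub>i E\<^sub>i + \<Sum> f\<^sub>j F\<^sub>j\<close> and set \<open>e\<^sub>i = 0\<close> for \<open>i > n\<close>. The vertices \<open>F\<^sub>j\<close> span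
  a Dynkin diagram of type \<open>E\<^sub>6\<close>, and
  \<open>- (Y \<cdot> Y) = 2 e\<^sub>0\<^sup>2 + \<Sum>\<^bsub>i \<le> n\<^esub> (e\<^sub>i - e\<^sub>i\<^sub>+\<^sub>1)\<^sup>2 + (Q f - 2 e\<^sub>0 f\<^sub>1)\<close>, where \<open>Q\<close> is the \<open>E\<^sub>6\<close> form.
  The last bracket is even and at least \<open>- 4 e\<^sub>0\<^sup>2 / 3\<close>, and the sum over the chain is at least
  \<open>\<bar>e\<^sub>0\<bar>\<close> and has the parity of \<open>e\<^sub>0\<close>, so a value of 2 or 3 forces \<open>\<bar>e\<^sub>0\<bar> \<le> 1\<close>. For a positive
  divisor with \<open>e\<^sub>0 = 0\<close>, \<open>Y\<close> is one of the \<open>n (n + 1) / 2\<close> positive roots of \<open>A\<^sub>n\<close> or of the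
  36 positive roots of \<open>E\<^sub>6\<close>. If \<open>e\<^sub>0 = 1\<close>, the chain part is one of the \<open>n + 1\<close> initial segments
  and \<open>f\<close> is one of the 27 solutions of \<open>Q f = 2 f\<^sub>1\<close> (the weights of the minuscule
  representation). Negation doubles the count.
\<close>

section \<open>The \<open>E6\<close> form: coordinate bounds and enumeration of short
  vectors\<close>

type_synonym e6 = "int \<times> int \<times> int \<times> int \<times> int \<times> int"

text \<open>Minus the self-intersection on the span of \<open>F 1\<close>, ..., \<open>F 6\<close>:
  the entries \<open>a\<close>, \<open>b\<close>, \<open>c\<close>, \<open>d\<close>,
  \<open>p\<close> run along the chain and \<open>q\<close> is the branch at
  \<open>c\<close>.\<close>

fun e6_form :: "e6 \<Rightarrow> int" where
  "e6_form (a, b, c, d, p, q) =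
     2 * (a^2 + b^2 + c^2 + d^2 + p^2 + q^2 - a * b - b * c - c * d - d * p - c * q)"

text \<open>The diagram automorphism; it carries the bounds for \<open>a\<close> and
  \<open>b\<close> over to \<open>p\<close> and \<open>d\<close>.\<close>

lemma e6_form_rev: "e6_form (p, d, c, b, a, q) = e6_form (a, b, c, d, p, q)"
  by (simp add: algebra_simps)

text \<open>The best constant in a bound of this kind is a diagonal entry of the inverse Cartan
  matrix. For \<open>E6\<close> these entries are 4/3, 10/3, 6, 10/3, 4/3, 2, in the order of the
  coordinates.\<close>

lemma e6_form_ge_1: "3 * a^2 \<le> 4 * e6_form (a, b, c, d, p, q)"
proof -
  \<comment> \<open>Completing squares from the other leaves inwards eliminates \<open>p\<close>,
    \<open>d\<close>, \<open>q\<close>, \<open>c\<close>, \<open>b\<close> in turn and leaves a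
    multiple of \<open>a^2\<close>.\<close>
  have "60 * e6_form (a, b, c, d, p, q) = 30 * (2*p-d)^2 + 10 * (3*d-2*c)^2 + 30 * (2*q-c)^2
      + 2 * (5*c-6*b)^2 + 3 * (4*b-5*a)^2 + 45 * a^2"
    by (simp add: algebra_simps power2_eq_square)
  moreover have "0 \<le> (2*p-d)^2" "0 \<le> (3*d-2*c)^2" "0 \<le> (2*q-c)^2" "0 \<le> (5*c-6*b)^2"
      "0 \<le> (4*b-5*a)^2" by simp_all
  ultimately show ?thesis by linarith
qed

lemma e6_form_ge_2: "3 * b^2 \<le> 10 * e6_form (a, b, c, d, p, q)"
proof -
  have "30 * e6_form (a, b, c, d, p, q) = 15 * (2*a-b)^2 + 15 * (2*p-d)^2 + 5 * (3*d-2*c)^2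
      + 15 * (2*q-c)^2 + (5*c-6*b)^2 + 9 * b^2"
    by (simp add: algebra_simps power2_eq_square)
  moreover have "0 \<le> (2*a-b)^2" "0 \<le> (2*p-d)^2" "0 \<le> (3*d-2*c)^2" "0 \<le> (2*q-c)^2"
      "0 \<le> (5*c-6*b)^2" by simp_all
  ultimately show ?thesis by linarith
qed

lemma e6_form_ge_3: "c^2 \<le> 6 * e6_form (a, b, c, d, p, q)"
proof -
  have "6 * e6_form (a, b, c, d, p, q) = 3 * (2*a-b)^2 + (3*b-2*c)^2 + 3 * (2*p-d)^2
      + (3*d-2*c)^2 + 3 * (2*q-c)^2 + c^2"
    by (simp add: algebra_simps power2_eq_square)
  moreover have "0 \<le> (2*a-b)^2" "0 \<le> (2*p-d)^2" "0 \<le> (3*d-2*c)^2" "0 \<le> (2*q-c)^2"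
      "0 \<le> (3*b-2*c)^2" by simp_all
  ultimately show ?thesis by linarith
qed

lemma e6_form_ge_6: "q^2 \<le> 2 * e6_form (a, b, c, d, p, q)"
proof -
  have "6 * e6_form (a, b, c, d, p, q) = 3 * (2*a-b)^2 + (3*b-2*c)^2 + 3 * (2*p-d)^2
      + (3*d-2*c)^2 + (2*c-3*q)^2 + 3 * q^2"
    by (simp add: algebra_simps power2_eq_square)
  moreover have "0 \<le> (2*a-b)^2" "0 \<le> (2*p-d)^2" "0 \<le> (3*d-2*c)^2" "0 \<le> (2*c-3*q)^2"
      "0 \<le> (3*b-2*c)^2" by simp_all
  ultimately show ?thesis by linarith
qed

lemmas e6_form_ge_4 = e6_form_ge_2[where a = p and b = d and d = b and p = a for p d b a,
    unfolded e6_form_rev]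
lemmas e6_form_ge_5 = e6_form_ge_1[where a = p and b = d and d = b and p = a for p d b a,
    unfolded e6_form_rev]
text \<open>The strict form rounds bounds that are not perfect squares: a square at most 12 is below
  16, so the base is at most 3.\<close>

lemma square_le_imp_bounds:
  fixes x m :: int
  assumes "x^2 < (m + 1)^2" "0 \<le> m"
  shows "- m \<le> x" "x \<le> m"
  using power2_less_imp_less[of "\<bar>x\<bar>" "m + 1"] assms by auto

lemma e6_form_nonneg: "0 \<le> e6_form f"
proof (cases f rule: e6_form.cases)
  case (1 a b c d p q)
  show ?thesis
    using e6_form_ge_3[of c a b d p q] zero_le_power2[of c] unfolding 1 by linarith
qed

lemma even_e6_form: "even (e6_form f)"
  by (cases f rule: e6_form.cases) simp

lemma e6_form_eq_0_iff: "e6_form f = 0 \<longleftrightarrow> f = (0, 0, 0, 0, 0, 0)"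
proof
  assume f0: "e6_form f = 0"
  obtain a b c d p q where f: "f = (a, b, c, d, p, q)" by (rule prod_cases6)
  note z = f0[unfolded f]
  have "a^2 \<le> 0" "b^2 \<le> 0" "c^2 \<le> 0" "d^2 \<le> 0" "p^2 \<le> 0" "q^2 \<le> 0"
    using e6_form_ge_1[of a b c d p q] e6_form_ge_2[of b a c d p q] e6_form_ge_3[of c a b d p q]
      e6_form_ge_4[of d a b c p q] e6_form_ge_5[of p a b c d q] e6_form_ge_6[of q a b c d p] z
    by linarith+
  then show "f = (0, 0, 0, 0, 0, 0)" by (simp add: f)
qed simp

text \<open>Completing the square: \<open>(4, 5, 6, 4, 2, 3) / 3\<close> is the fundamental weight dual to
  \<open>F\<^sub>1\<close>, of norm \<open>4 / 3\<close>.\<close>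

lemma e6_form_shift:
  "e6_form (3*a - 4*k, 3*b - 5*k, 3*c - 6*k, 3*d - 4*k, 3*p - 2*k, 3*q - 3*k) =
     9 * (e6_form (a, b, c, d, p, q) - 2 * k * a) + 12 * k^2"
  by (simp add: algebra_simps power2_eq_square)

fun e6_nonneg :: "e6 \<Rightarrow> bool" where
  "e6_nonneg (a, b, c, d, p, q) \<longleftrightarrow> 0 \<le> a \<and> 0 \<le> b \<and> 0 \<le> c \<and> 0 \<le> d \<and> 0 \<le> p \<and> 0 \<le> q"

definition e6_box :: "int \<Rightarrow> int \<Rightarrow> int \<Rightarrow> int \<Rightarrow> int \<Rightarrow> int \<Rightarrow> e6 list" where
  "e6_box a b c d p q = List.product [0..a] (List.product [0..b] (List.product [0..c]
     (List.product [0..d] (List.product [0..p] [0..q]))))"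

lemma distinct_e6_box: "distinct (e6_box a b c d p q)"
  by (simp add: e6_box_def distinct_product)

definition e6_roots :: "e6 set" where
  "e6_roots = {f. e6_nonneg f \<and> e6_form f = 2}"

definition e6_minuscule :: "e6 set" where
  "e6_minuscule = {f. e6_nonneg f \<and> e6_form f = 2 * fst f}"

lemma e6_roots_eq: "e6_roots = set (filter (\<lambda>f. e6_form f = 2) (e6_box 1 2 3 2 1 2))"
proof -
  \<comment> \<open>The integer parts of the square roots of 8/3, 20/3, 12, 20/3, 8/3, 4; they are
    also the coefficients of the highest root.\<close>
  have "a \<le> 1 \<and> b \<le> 2 \<and> c \<le> 3 \<and> d \<le> 2 \<and> p \<le> 1 \<and> q \<le> 2"
    if "e6_form (a, b, c, d, p, q) = 2" for a b c d p q
    using e6_form_ge_1[of a b c d p q] e6_form_ge_2[of b a c d p q] e6_form_ge_3[of c a b d p q]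
      e6_form_ge_4[of d a b c p q] e6_form_ge_5[of p a b c d q] e6_form_ge_6[of q a b c d p]
      square_le_imp_bounds(2)[of a 1] square_le_imp_bounds(2)[of b 2] square_le_imp_bounds(2)[of c 3]
      square_le_imp_bounds(2)[of d 2] square_le_imp_bounds(2)[of p 1] square_le_imp_bounds(2)[of q 2]
    unfolding that by simp
  then show ?thesis
    unfolding e6_roots_def e6_box_def by (auto simp del: e6_form.simps)
qed

lemma e6_minuscule_eq:
  "e6_minuscule = set (filter (\<lambda>f. e6_form f = 2 * fst f) (e6_box 2 3 4 3 2 2))"
proof -
  have "a \<le> 2 \<and> b \<le> 3 \<and> c \<le> 4 \<and> d \<le> 3 \<and> p \<le> 2 \<and> q \<le> 2"
    if "e6_form (a, b, c, d, p, q) = 2 * a" for a b c d p q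
  proof -
    let ?a = "3*a - 4" and ?b = "3*b - 5" and ?c = "3*c - 6" and ?d = "3*d - 4"
      and ?p = "3*p - 2" and ?q = "3*q - 3"
    \<comment> \<open>The shift with \<open>k = 1\<close> puts the solutions on a sphere around the
      fundamental weight: the bracket vanishes and 12 remains. Rounding the shifted coordinates, and
      again after division by 3, gives the box.\<close>
    have "e6_form (?a, ?b, ?c, ?d, ?p, ?q) = 12"
      using e6_form_shift[of a 1 b c d p q] that by simp
    then have "?a \<le> 4" "?b \<le> 6" "?c \<le> 8" "?d \<le> 6" "?p \<le> 4" "?q \<le> 4"
      using e6_form_ge_1[of ?a ?b ?c ?d ?p ?q] e6_form_ge_2[of ?b ?a ?c ?d ?p ?q]
        e6_form_ge_3[of ?c ?a ?b ?d ?p ?q] e6_form_ge_4[of ?d ?a ?b ?c ?p ?q]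
        e6_form_ge_5[of ?p ?a ?b ?c ?d ?q] e6_form_ge_6[of ?q ?a ?b ?c ?d ?p]
        square_le_imp_bounds(2)[of ?a 4] square_le_imp_bounds(2)[of ?b 6]
        square_le_imp_bounds(2)[of ?c 8] square_le_imp_bounds(2)[of ?d 6]
        square_le_imp_bounds(2)[of ?p 4] square_le_imp_bounds(2)[of ?q 4]
      by (simp_all del: e6_form.simps)
    then show ?thesis by linarith
  qed
  then show ?thesis
    unfolding e6_minuscule_def e6_box_def by (auto simp del: e6_form.simps)
qed

lemma finite_e6: "finite e6_roots" "finite e6_minuscule"
  by (simp_all only: e6_roots_eq e6_minuscule_eq finite_set)

text \<open>Evaluating the nested sums by rewriting avoids building the whole box as one term.\<close>

lemma length_filter_product:
  "length (filter P (List.product xs ys)) = (\<Sum>x\<leftarrow>xs. length (filter (\<lambda>y. P (x, y)) ys))"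
  by (induction xs) (simp_all add: filter_map comp_def)

lemma card_e6_roots: "card e6_roots = 36"
proof -
  have "length (filter (\<lambda>f. e6_form f = 2) (e6_box 1 2 3 2 1 2)) = 36"
    unfolding e6_box_def length_filter_product by code_simp
  then show ?thesis
    by (simp only: e6_roots_eq distinct_card distinct_filter distinct_e6_box)
qed

lemma card_e6_minuscule: "card e6_minuscule = 27"
proof -
  have "length (filter (\<lambda>f. e6_form f = 2 * fst f) (e6_box 2 3 4 3 2 2)) = 27"
    unfolding e6_box_def length_filter_product by code_simp
  then show ?thesis
    by (simp only: e6_minuscule_eq distinct_card distinct_filter distinct_e6_box)
qed

section \<open>The chain, studied through its successive differences\<close>

definition chain_form :: "nat \<Rightarrow> (nat \<Rightarrow> int) \<Rightarrow> int" where
  "chain_form n e = (\<Sum>i\<le>n. (e i - e (Suc i))^2)"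

lemma chain_form_nonneg: "0 \<le> chain_form n e"
  by (simp add: chain_form_def sum_nonneg)

text \<open>The drops \<open>e i - e (Suc i)\<close> determine \<open>e\<close> and sum to
  \<open>e 0\<close>, so questions about the chain become questions about integer vectors with a
  small sum of squares.\<close>

lemma chain_telescope:
  fixes e :: "nat \<Rightarrow> int"
  assumes "\<And>i. i > n \<Longrightarrow> e i = 0" "k \<le> Suc n"
  shows "e k = (\<Sum>i\<in>{k..n}. e i - e (Suc i))"
proof -
  have "(\<Sum>i\<in>{k..n}. e i - e (Suc i)) = - (\<Sum>i\<in>{k..n}. e (Suc i) - e i)"
    by (simp add: sum_negf[symmetric])
  also have "\<dots> = e k" using assms by (simp add: sum_Suc_diff)
  finally show ?thesis ..
qed

lemma chain_form_eq_0:
  assumes "chain_form n e = 0" "\<And>i. i > n \<Longrightarrow> e i = 0"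
  shows "e = (\<lambda>_. 0)"
proof
  fix k
  have z: "\<forall>i\<le>n. e i - e (Suc i) = 0"
    using assms(1) by (simp add: chain_form_def sum_nonneg_eq_0_iff)
  show "e k = 0"
  proof (cases "k \<le> n")
    case True
    then show ?thesis using chain_telescope[of n e k] assms(2) z by simp
  qed (use assms(2) in simp)
qed

text \<open>A square has the parity of its base, and the drops sum to \<open>e 0\<close>.\<close>

lemma chain_form_parity:
  assumes "\<And>i. i > n \<Longrightarrow> e i = 0"
  shows "even (chain_form n e) \<longleftrightarrow> even (e 0)"
proof -
  have "even (\<Sum>i\<in>A. x i ^ 2) \<longleftrightarrow> even (\<Sum>i\<in>A. x i)" if "finite A" for A and x :: "nat \<Rightarrow> int"
    using that by (induction A rule: finite_induct) auto
  from this[of "{..n}" "\<lambda>i. e i - e (Suc i)"] show ?thesis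
    using chain_telescope[of n e 0] assms by (simp add: chain_form_def atMost_atLeast0)
qed

text \<open>An integer is at most its square; this is summed over the drops.\<close>

lemma chain_form_ge:
  assumes "\<And>i. i > n \<Longrightarrow> e i = 0"
  shows "e 0 \<le> chain_form n e"
proof -
  have "x \<le> x^2" for x :: int
    using self_le_power[of x 2] zero_le_power2[of x] by linarith
  then show ?thesis
    using chain_telescope[of n e 0] assms
    by (simp add: chain_form_def atMost_atLeast0) (rule sum_mono, simp)
qed

lemma int_square_le_1:
  fixes x :: int
  assumes "x^2 \<le> 1" "x \<noteq> 0"
  shows "x = 1 \<or> x = - 1"
  using square_le_imp_bounds[of x 1] assms by auto

lemma sum_squares_eq_1:
  fixes x :: "'a \<Rightarrow> int"
  assumes "finite A" "(\<Sum>i\<in>A. x i ^ 2) = 1"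
  obtains j where "j \<in> A" "x j = 1 \<or> x j = - 1" "\<And>i. i \<in> A - {j} \<Longrightarrow> x i = 0"
proof -
  obtain j where j: "j \<in> A" "x j \<noteq> 0"
    by (rule sum.not_neutral_contains_not_neutral[of "\<lambda>i. x i ^ 2" A]) (use assms(2) in auto)
  have s: "(\<Sum>i\<in>A. x i ^ 2) = x j ^ 2 + (\<Sum>i\<in>A - {j}. x i ^ 2)"
    using assms(1) j(1) by (rule sum.remove)
  have ge: "0 \<le> (\<Sum>i\<in>A - {j}. x i ^ 2)" by (simp add: sum_nonneg)
  have jj: "x j = 1 \<or> x j = - 1" using s ge assms(2) j(2) int_square_le_1[of "x j"] by linarith
  then have "x j ^ 2 = 1" by auto
  then have "(\<Sum>i\<in>A - {j}. x i ^ 2) = 0" using s assms(2) by linarith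
  then have "x i = 0" if "i \<in> A - {j}" for i
    using that assms(1) by (simp add: sum_nonneg_eq_0_iff)
  with j(1) jj show ?thesis by (rule that)
qed

text \<open>A non-zero entry must have square 1, since 4 is too large; removing it leaves a sum of
  squares equal to 1.\<close>

lemma sum_squares_eq_2:
  fixes x :: "'a \<Rightarrow> int"
  assumes "finite A" "(\<Sum>i\<in>A. x i ^ 2) = 2"
  obtains j k where "j \<in> A" "k \<in> A" "j \<noteq> k" "x j = 1 \<or> x j = - 1" "x k = 1 \<or> x k = - 1"
    "\<And>i. i \<in> A - {j, k} \<Longrightarrow> x i = 0"
proof -
  obtain j where j: "j \<in> A" "x j \<noteq> 0"
    by (rule sum.not_neutral_contains_not_neutral[of "\<lambda>i. x i ^ 2" A]) (use assms(2) in auto)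
  have s: "(\<Sum>i\<in>A. x i ^ 2) = x j ^ 2 + (\<Sum>i\<in>A - {j}. x i ^ 2)"
    using assms(1) j(1) by (rule sum.remove)
  have ge: "0 \<le> (\<Sum>i\<in>A - {j}. x i ^ 2)" by (simp add: sum_nonneg)
  then have "x j ^ 2 < (1 + 1)^2" using s assms(2) by simp
  then have jj: "x j = 1 \<or> x j = - 1"
    using j(2) square_le_imp_bounds[of "x j" 1] by auto
  then have "x j ^ 2 = 1" by auto
  then have "(\<Sum>i\<in>A - {j}. x i ^ 2) = 1" using s assms(2) by linarith
  then obtain k where "k \<in> A - {j}" "x k = 1 \<or> x k = - 1" "\<And>i. i \<in> A - {j} - {k} \<Longrightarrow> x i = 0"
    using sum_squares_eq_1[of "A - {j}" x] assms(1) by auto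
  then show ?thesis using that[of j k] j(1) jj by auto
qed

definition initial_chains :: "nat \<Rightarrow> (nat \<Rightarrow> int) set" where
  "initial_chains n = (\<lambda>j k. if k \<le> j then 1 else 0) ` {..n}"

text \<open>The left end is exclusive, so that \<open>i\<close> and \<open>j\<close> are exactly the
  positions of the drops -1 and 1. These are the positive roots of the \<open>A_n\<close> diagram on
  \<open>E 1\<close>, ..., \<open>E n\<close>.\<close>

definition inner_chains :: "nat \<Rightarrow> (nat \<Rightarrow> int) set" where
  "inner_chains n = (\<lambda>(j, i) k. if i < k \<and> k \<le> j then 1 else 0) ` (SIGMA j:{..n}. {..<j})"

lemma finite_chains: "finite (initial_chains n)" "finite (inner_chains n)"
  by (simp_all add: initial_chains_def inner_chains_def)

lemma card_initial_chains: "card (initial_chains n) = n + 1"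
proof -
  have "inj_on (\<lambda>j k. if k \<le> j then 1 else (0::int)) {..n}"
  proof (rule inj_onI)
    fix i j :: nat
    assume "(\<lambda>k. if k \<le> i then 1 else 0::int) = (\<lambda>k. if k \<le> j then 1 else 0)"
    from fun_cong[OF this, of i] fun_cong[OF this, of j] show "i = j"
      by (simp split: if_splits)
  qed
  then show ?thesis by (simp add: initial_chains_def card_image)
qed

lemma card_inner_chains: "2 * card (inner_chains n) = n * (n + 1)"
proof -
  have "inj_on (\<lambda>(j, i) k. if i < k \<and> k \<le> j then 1 else (0::int)) (SIGMA j:{..n}. {..<j})"
  proof (rule inj_onI, clarify)
    fix j i j' i' :: nat
    assume ij: "i < j" "i' < j'"
    assume "(\<lambda>k. if i < k \<and> k \<le> j then 1 else 0::int) = (\<lambda>k. if i' < k \<and> k \<le> j' then 1 else 0)"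
    note eq = fun_cong[OF this]
    have jj: "j = j'" using eq[of j] eq[of j'] ij by (simp split: if_splits)
    moreover have "i = i'"
      using eq[of "Suc i"] eq[of "Suc i'"] ij jj by (simp split: if_splits)
    ultimately show "j = j' \<and> i = i'" by simp
  qed
  then have "card (inner_chains n) = (\<Sum>j\<le>n. j)"
    by (simp add: inner_chains_def card_image)
  moreover have "2 * (\<Sum>j\<le>n. j) = n * (n + 1)" by (induction n) auto
  ultimately show ?thesis by simp
qed

text \<open>A sum of squares 1 leaves a single non-zero drop, which equals 1 because the drops sum
  to \<open>e 0 = 1\<close>.\<close>

lemma initial_chain_iff:
  "e \<in> initial_chains n \<longleftrightarrow> (\<forall>i>n. e i = 0) \<and> e 0 = 1 \<and> chain_form n e = 1"
proof
  assume "e \<in> initial_chains n"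
  then obtain j where j: "j \<le> n" and e: "e = (\<lambda>k. if k \<le> j then 1 else 0)"
    by (auto simp: initial_chains_def)
  have "chain_form n e = (\<Sum>i\<le>n. if i = j then 1 else 0)"
    unfolding chain_form_def e by (rule sum.cong) auto
  then show "(\<forall>i>n. e i = 0) \<and> e 0 = 1 \<and> chain_form n e = 1" using j e by simp
next
  assume a: "(\<forall>i>n. e i = 0) \<and> e 0 = 1 \<and> chain_form n e = 1"
  let ?d = "\<lambda>i. e i - e (Suc i)"
  obtain j where j: "j \<in> {..n}" "?d j = 1 \<or> ?d j = - 1" "\<And>i. i \<in> {..n} - {j} \<Longrightarrow> ?d i = 0"
    using sum_squares_eq_1[of "{..n}" ?d] a unfolding chain_form_def by auto
  have ek: "e k = (if k \<le> j then ?d j else 0)" if "k \<le> n" for k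
  proof -
    have "e k = (\<Sum>i\<in>{k..n}. ?d i)" using chain_telescope[of n e k] a that by simp
    also have "\<dots> = (\<Sum>i\<in>{k..n}. if i = j then ?d j else 0)"
      using j(3) by (intro sum.cong) auto
    finally show ?thesis using j(1) by simp
  qed
  from ek[of 0] a have "?d j = 1" by simp
  then have "e = (\<lambda>k. if k \<le> j then 1 else 0)"
    using ek a j(1) by (intro ext) (metis atMost_iff le_trans not_le)
  then show "e \<in> initial_chains n" using j(1) by (auto simp: initial_chains_def)
qed

text \<open>There are exactly two non-zero drops, opposite to each other because they sum to
  \<open>e 0 = 0\<close>; non-negativity decides their order.\<close>

lemma inner_chain_iff:
  "e \<in> inner_chains n \<longleftrightarrow>
     (\<forall>i>n. e i = 0) \<and> (\<forall>i. 0 \<le> e i) \<and> e 0 = 0 \<and> chain_form n e = 2"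
proof
  assume "e \<in> inner_chains n"
  then obtain i j where j: "j \<le> n" "i < j" and e: "e = (\<lambda>k. if i < k \<and> k \<le> j then 1 else 0)"
    by (auto simp: inner_chains_def)
  have "chain_form n e = (\<Sum>k\<le>n. (if k = j then 1 else 0) + (if k = i then 1 else 0))"
    unfolding chain_form_def e using j by (intro sum.cong) auto
  also have "\<dots> = 2" using j by (simp add: sum.distrib)
  finally show "(\<forall>i>n. e i = 0) \<and> (\<forall>i. 0 \<le> e i) \<and> e 0 = 0 \<and> chain_form n e = 2"
    using j e by simp
next
  assume a: "(\<forall>i>n. e i = 0) \<and> (\<forall>i. 0 \<le> e i) \<and> e 0 = 0 \<and> chain_form n e = 2"
  let ?d = "\<lambda>i. e i - e (Suc i)"
  have "\<exists>i j. i \<le> n \<and> j \<le> n \<and> i < j \<and> (?d i = 1 \<or> ?d i = - 1) \<and> (?d j = 1 \<or> ?d j = - 1) \<and>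
      (\<forall>l\<in>{..n} - {i, j}. ?d l = 0)"
  proof -
    obtain j k where jk: "j \<in> {..n}" "k \<in> {..n}" "j \<noteq> k" "?d j = 1 \<or> ?d j = - 1"
        "?d k = 1 \<or> ?d k = - 1" "\<And>i. i \<in> {..n} - {j, k} \<Longrightarrow> ?d i = 0"
      using sum_squares_eq_2[of "{..n}" ?d] a unfolding chain_form_def by auto
    show ?thesis
    proof (cases "j < k")
      case True
      show ?thesis by (rule exI[of _ j], rule exI[of _ k]) (use jk True in auto)
    next
      case False
      show ?thesis by (rule exI[of _ k], rule exI[of _ j]) (use jk False in auto)
    qed
  qed
  then obtain i j where ij: "i \<le> n" "j \<le> n" "i < j" "?d i = 1 \<or> ?d i = - 1"
      "?d j = 1 \<or> ?d j = - 1" "\<And>l. l \<in> {..n} - {i, j} \<Longrightarrow> ?d l = 0" by blast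
  have ek: "e k = (if k \<le> i then ?d i else 0) + (if k \<le> j then ?d j else 0)" if "k \<le> n" for k
  proof -
    have "e k = (\<Sum>l\<in>{k..n}. ?d l)" using chain_telescope[of n e k] a that by simp
    also have "\<dots> = (\<Sum>l\<in>{k..n}. (if l = i then ?d i else 0) + (if l = j then ?d j else 0))"
      using ij(3,6) by (intro sum.cong) auto
    finally show ?thesis using ij(1,2) by (simp add: sum.distrib)
  qed
  have "?d i + ?d j = 0" using ek[of 0] a by simp
  \<comment> \<open>No drop after \<open>j\<close> is non-zero, so the drop at \<open>j\<close> is
    the value \<open>e j\<close>.\<close>
  moreover have "?d j \<ge> 0" using ek[of j] a ij(2,3) by (metis add_0 le_refl not_le)
  ultimately have dij: "?d j = 1" "?d i = - 1" using ij(5) by linarith+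
  have "e k = (if i < k \<and> k \<le> j then 1 else 0)" for k
  proof (cases "k \<le> n")
    case True
    show ?thesis using ek[OF True] ij(3) unfolding dij by auto
  next
    case False
    then show ?thesis using a ij(2) by simp
  qed
  then have "e = (\<lambda>(j, i) k. if i < k \<and> k \<le> j then 1 else 0) (j, i)" by auto
  then show "e \<in> inner_chains n" unfolding inner_chains_def using ij by blast
qed

section \<open>Coordinates on the lattice and the self-intersection formula\<close>

fun divisor :: "(nat \<Rightarrow> int) \<times> e6 \<Rightarrow> vertex \<Rightarrow> int" where
  "divisor (e, a, b, c, d, p, q) (E i) = e i"
| "divisor (e, a, b, c, d, p, q) (F i) =
     (if i = 1 then a else if i = 2 then b else if i = 3 then c else if i = 4 then d
      else if i = 5 then p else if i = 6 then q else 0)"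

lemma inj_divisor: "inj divisor"
proof (rule injI)
  fix x y assume eq: "divisor x = divisor y"
  obtain e a b c d p q where x: "x = (e, a, b, c, d, p, q)" by (rule prod_cases7)
  obtain e' a' b' c' d' p' q' where y: "y = (e', a', b', c', d', p', q')" by (rule prod_cases7)
  have "e i = e' i" for i using fun_cong[OF eq, of "E i"] by (simp add: x y)
  moreover have "a = a'" "b = b'" "c = c'" "d = d'" "p = p'" "q = q'"
    using fun_cong[OF eq, of "F 1"] fun_cong[OF eq, of "F 2"] fun_cong[OF eq, of "F 3"]
      fun_cong[OF eq, of "F 4"] fun_cong[OF eq, of "F 5"] fun_cong[OF eq, of "F 6"]
    by (simp_all add: x y)
  ultimately show "x = y" by (auto simp: x y)
qed

text \<open>Only \<open>e\<close> is constrained, because \<open>divisor\<close> has the default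
  value 0 at every \<open>F i\<close> with \<open>i\<close> outside 1 to 6.\<close>

lemma divisor_in_lattice_iff:
  "divisor (e, f) \<in> vertex_lattice (F_tree n) \<longleftrightarrow> (\<forall>i>n. e i = 0)"
proof -
  obtain a b c d p q where f: "f = (a, b, c, d, p, q)" by (rule prod_cases6)
  have "divisor (e, f) v = 0" if "\<forall>i>n. e i = 0" "v \<notin> verts (F_tree n)" for v
    using that by (cases v) (auto simp: F_tree_def f image_iff not_le)
  moreover have "e i = 0" if "divisor (e, f) \<in> vertex_lattice (F_tree n)" "i > n" for i
  proof -
    have "E i \<notin> verts (F_tree n)" using that(2) by (auto simp: F_tree_def)
    then have "divisor (e, f) (E i) = 0" using that(1) by (simp add: vertex_lattice_def)
    then show ?thesis by (simp add: f)
  qed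
  ultimately show ?thesis by (auto simp: vertex_lattice_def)
qed

lemma lattice_divisorE:
  assumes "Y \<in> vertex_lattice (F_tree n)"
  obtains x where "Y = divisor x"
proof (rule that)
  show "Y = divisor (\<lambda>i. Y (E i), Y (F 1), Y (F 2), Y (F 3), Y (F 4), Y (F 5), Y (F 6))"
    (is "_ = ?Z")
  proof
    fix v
    show "Y v = ?Z v"
    proof (cases v)
      case (F i)
      have "F i \<in> verts (F_tree n) \<longleftrightarrow> i \<in> {1..6}" by (auto simp: F_tree_def)
      then have "Y (F i) = 0" if "i \<notin> {1..6}" using assms that by (simp add: vertex_lattice_def)
      then show ?thesis unfolding F by auto
    qed simp
  qed
qed

lemma atLeastAtMost_1_6: "{1..6::nat} = {1, 2, 3, 4, 5, 6}" by auto

lemma vertex_intersection_F_tree: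
  "vertex_intersection (F_tree n) (E i) (E j) =
     (if i = j then (if i = 0 then - 3 else - 2)
      else if i = Suc j \<and> j < n \<or> j = Suc i \<and> i < n then 1 else 0)"
  "vertex_intersection (F_tree n) (E i) (F k) = (if i = 0 \<and> k = 1 then 1 else 0)"
  "vertex_intersection (F_tree n) (F k) (E i) = (if i = 0 \<and> k = 1 then 1 else 0)"
  "vertex_intersection (F_tree n) (F k) (F l) =
     (if k = l then - 2 else if {k, l} \<in> {{1, 2}, {2, 3}, {3, 4}, {4, 5}, {3, 6}} then 1 else 0)"
  by (auto simp: vertex_intersection_def F_tree_def doubleton_eq_iff)

text \<open>The squared differences supply \<open>e 0\<close> with coefficient 1 and every later
  vertex with coefficient 2; weight 3 at \<open>E 0\<close> accounts for the extra
  \<open>2 * e 0 ^ 2\<close>.\<close>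

lemma chain_self_intersection:
  fixes e :: "nat \<Rightarrow> int"
  assumes "e (Suc n) = 0"
  shows "(\<Sum>i\<le>n. \<Sum>j\<le>n. e i * e j * vertex_intersection (F_tree n) (E i) (E j)) =
    - (2 * e 0 ^ 2 + chain_form n e)"
proof -
  \<comment> \<open>The matrix of an infinite chain, independent of \<open>n\<close>, so that
    induction on the truncation \<open>N\<close> is possible.\<close>
  define m :: "nat \<Rightarrow> nat \<Rightarrow> int" where
    "m i j = (if i = j then (if i = 0 then - 3 else - 2) else if i = Suc j \<or> j = Suc i then 1 else 0)"
    for i j
  have "(\<Sum>i\<le>N. \<Sum>j\<le>N. e i * e j * m i j) =
      - (2 * e 0 ^ 2 + (\<Sum>i<N. (e i - e (Suc i))^2) + e N ^ 2)" for N
  proof (induction N)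
    case 0
    show ?case by (simp add: m_def power2_eq_square)
  next
    case (Suc N)
    have row: "(\<Sum>j\<le>N. e (Suc N) * e j * m (Suc N) j) = e (Suc N) * e N"
    proof -
      have "(\<Sum>j\<le>N. e (Suc N) * e j * m (Suc N) j) = (\<Sum>j\<le>N. if j = N then e (Suc N) * e N else 0)"
        by (rule sum.cong) (auto simp: m_def)
      then show ?thesis by simp
    qed
    have col: "(\<Sum>i\<le>N. e i * e (Suc N) * m i (Suc N)) = e (Suc N) * e N"
    proof -
      have "(\<Sum>i\<le>N. e i * e (Suc N) * m i (Suc N)) = (\<Sum>j\<le>N. if j = N then e (Suc N) * e N else 0)"
        by (rule sum.cong) (auto simp: m_def)
      then show ?thesis by simp
    qed
    have diag: "m (Suc N) (Suc N) = - 2" by (simp add: m_def)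
    show ?case
      by (simp add: sum.distrib row col diag Suc.IH) (simp add: power2_eq_square algebra_simps)
  qed
  from this[of n] have "(\<Sum>i\<le>n. \<Sum>j\<le>n. e i * e j * m i j) = - (2 * e 0 ^ 2 + chain_form n e)"
    using assms by (simp add: chain_form_def lessThan_Suc_atMost[symmetric])
  moreover have "vertex_intersection (F_tree n) (E i) (E j) = m i j" if "i \<le> n" "j \<le> n" for i j
    using that by (auto simp: vertex_intersection_F_tree m_def)
  ultimately show ?thesis by simp
qed

text \<open>The only edge between the two parts joins \<open>E 0\<close> to \<open>F 1\<close>;
  counted in both orders it gives the cross term.\<close>

lemma divisor_self_intersection:
  assumes "\<forall>i>n. e i = 0"
  shows "intersection_form (F_tree n) (divisor (e, f)) (divisor (e, f)) =
    - (2 * e 0 ^ 2 + chain_form n e + (e6_form f - 2 * e 0 * fst f))"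
proof -
  obtain a b c d p q where f: "f = (a, b, c, d, p, q)" by (rule prod_cases6)
  have split: "(\<Sum>v\<in>verts (F_tree n). h v) = (\<Sum>i\<le>n. h (E i)) + (\<Sum>k\<in>{1..6}. h (F k))"
    for h :: "vertex \<Rightarrow> int"
  proof -
    have "(\<Sum>v\<in>verts (F_tree n). h v) = (\<Sum>v\<in>E ` {..n}. h v) + (\<Sum>v\<in>F ` {1..6}. h v)"
      unfolding F_tree_def weighted_graph.select_convs atLeast0AtMost
      by (rule sum.union_disjoint) auto
    then show ?thesis by (simp add: sum.reindex inj_on_def)
  qed
  have EF: "(\<Sum>i\<le>n. e i * y * vertex_intersection (F_tree n) (E i) (F k)) =
      (if k = 1 then e 0 * y else 0)" for y k
  proof -
    have "(\<Sum>i\<le>n. e i * y * vertex_intersection (F_tree n) (E i) (F k)) =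
        (\<Sum>i\<le>n. if i = 0 then (if k = 1 then e 0 * y else 0) else 0)"
      by (rule sum.cong) (auto simp: vertex_intersection_F_tree)
    then show ?thesis by simp
  qed
  have FE: "(\<Sum>i\<le>n. y * e i * vertex_intersection (F_tree n) (F k) (E i)) =
      (if k = 1 then e 0 * y else 0)" for y k
    using EF[of y k] by (simp add: vertex_intersection_F_tree mult.commute)
  let ?Y = "divisor (e, f)"
  let ?FF = "\<Sum>k\<in>{1..6}. \<Sum>l\<in>{1..6}. ?Y (F k) * ?Y (F l) * vertex_intersection (F_tree n) (F k) (F l)"
  have "?FF = - e6_form f"
    unfolding atLeastAtMost_1_6 f
    by (simp add: vertex_intersection_F_tree doubleton_eq_iff power2_eq_square algebra_simps)
  moreover have "(\<Sum>i\<le>n. \<Sum>k\<in>{1..6}. ?Y (E i) * ?Y (F k) * vertex_intersection (F_tree n) (E i) (F k))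
      = e 0 * a"
    by (subst sum.swap) (simp add: f EF atLeastAtMost_1_6 del: divisor.simps(2), simp)
  moreover have "(\<Sum>k\<in>{1..6}. \<Sum>i\<le>n. ?Y (F k) * ?Y (E i) * vertex_intersection (F_tree n) (F k) (E i))
      = e 0 * a"
    by (simp add: f FE atLeastAtMost_1_6 del: divisor.simps(2), simp)
  moreover have "(\<Sum>i\<le>n. \<Sum>j\<le>n. ?Y (E i) * ?Y (E j) * vertex_intersection (F_tree n) (E i) (E j))
      = - (2 * e 0 ^ 2 + chain_form n e)"
    using chain_self_intersection[of e n] assms by (simp add: f)
  ultimately show ?thesis
    unfolding intersection_form_def split sum.distrib by (simp add: f)
qed

section \<open>Classification and count of the positive roots\<close>

definition positive_triple_roots :: "nat \<Rightarrow> (vertex \<Rightarrow> int) set" where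
  "positive_triple_roots n = {Y. positive_divisor (F_tree n) Y \<and>
     (intersection_form (F_tree n) Y Y = -2 \<or> intersection_form (F_tree n) Y Y = -3)}"

lemma intersection_form_zero: "intersection_form G (\<lambda>_. 0) (\<lambda>_. 0) = 0"
  by (simp add: intersection_form_def)

lemma intersection_form_uminus:
  "intersection_form G (\<lambda>v. - Y v) (\<lambda>v. - Y v) = intersection_form G Y Y"
  by (simp add: intersection_form_def)

lemma triple_root_system_F_tree:
  "triple_root_system (F_tree n) =
     positive_triple_roots n \<union> (\<lambda>Y v. - Y v) ` positive_triple_roots n"
proof -
  have neg: "negative_divisor G Y \<longleftrightarrow> positive_divisor G (\<lambda>v. - Y v)" for G :: "vertex weighted_graph" and Y
    by (auto simp: negative_divisor_def positive_divisor_def vertex_lattice_def fun_eq_iff)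
  have "Y \<in> (\<lambda>Y v. - Y v) ` A \<longleftrightarrow> (\<lambda>v. - Y v) \<in> A" for Y :: "vertex \<Rightarrow> int" and A
    by (auto simp: image_iff intro!: bexI[of _ "\<lambda>v. - Y v"])
  then show ?thesis
    by (auto simp: triple_root_system_def positive_triple_roots_def neg intersection_form_uminus)
qed

lemma positive_divisor_iff:
  "positive_divisor (F_tree n) (divisor (e, f)) \<longleftrightarrow>
     divisor (e, f) \<noteq> (\<lambda>_. 0) \<and> (\<forall>i>n. e i = 0) \<and> (\<forall>i. 0 \<le> e i) \<and> e6_nonneg f"
proof -
  obtain a b c d p q where f: "f = (a, b, c, d, p, q)" by (rule prod_cases6)
  have "(\<forall>v\<in>verts (F_tree n). divisor (e, f) v \<ge> 0) \<longleftrightarrow> (\<forall>i\<le>n. 0 \<le> e i) \<and> e6_nonneg f"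
    unfolding F_tree_def atLeastAtMost_1_6 by (auto simp: f)
  moreover have "(\<forall>i\<le>n. 0 \<le> e i) \<longleftrightarrow> (\<forall>i. 0 \<le> e i)" if "\<forall>i>n. e i = 0"
    using that by (metis not_le order_refl)
  ultimately show ?thesis
    unfolding positive_divisor_def divisor_in_lattice_iff by blast
qed

lemma positive_triple_roots_eq:
  "positive_triple_roots n = divisor `
     (inner_chains n \<times> {(0, 0, 0, 0, 0, 0)} \<union> {\<lambda>_. 0} \<times> e6_roots \<union> initial_chains n \<times> e6_minuscule)"
    (is "_ = divisor ` ?T")
proof -
  have mem: "divisor (e, f) \<in> positive_triple_roots n \<longleftrightarrow> (e, f) \<in> ?T" for e f
  proof -
    let ?Q = "2 * e 0 ^ 2 + chain_form n e + (e6_form f - 2 * e 0 * fst f)"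
    \<comment> \<open>The condition of being non-zero is absorbed, since the zero divisor has
      self-intersection 0.\<close>
    have "divisor (e, f) \<in> positive_triple_roots n \<longleftrightarrow>
        (\<forall>i>n. e i = 0) \<and> (\<forall>i. 0 \<le> e i) \<and> e6_nonneg f \<and> (?Q = 2 \<or> ?Q = 3)"
    proof (cases "\<forall>i>n. e i = 0")
      case True
      then show ?thesis
        using divisor_self_intersection[OF True, of f] intersection_form_zero[of "F_tree n"]
        by (auto simp: positive_triple_roots_def positive_divisor_iff)
    next
      case False
      then show ?thesis
        by (simp only: positive_triple_roots_def positive_divisor_iff mem_Collect_eq simp_thms)
    qed
    also have "\<dots> \<longleftrightarrow> (e, f) \<in> ?T"
    proof
      assume "(\<forall>i>n. e i = 0) \<and> (\<forall>i. 0 \<le> e i) \<and> e6_nonneg f \<and> (?Q = 2 \<or> ?Q = 3)"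
      then have e: "\<forall>i>n. e i = 0" "\<forall>i. 0 \<le> e i" and f: "e6_nonneg f" and Q: "?Q = 2 \<or> ?Q = 3"
        by auto
      have ge: "0 \<le> 9 * (e6_form f - 2 * e 0 * fst f) + 12 * e 0 ^ 2"
      proof -
        obtain a b c d p q where "f = (a, b, c, d, p, q)" by (rule prod_cases6)
        then show ?thesis
          using e6_form_shift[of a "e 0" b c d p q] e6_form_nonneg by (metis fst_conv)
      qed
      have D: "e 0 \<le> chain_form n e" "even (chain_form n e) \<longleftrightarrow> even (e 0)"
        using chain_form_ge[of n e] chain_form_parity[of n e] e(1) by auto
      \<comment> \<open>Nine times \<open>?Q \<le> 3\<close>, with the bracket bounded by
        \<open>ge\<close> and the chain by \<open>e 0\<close>. At \<open>e 0 = 2\<close> the left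
        side is already 42.\<close>
      have "6 * e 0 ^ 2 + 9 * e 0 \<le> 27" using Q ge D(1) by auto
      then have "e 0 < 2" using power_mono[of 2 "e 0" 2] by (cases "e 0 \<ge> 2") auto
      with e(2) consider "e 0 = 0" | "e 0 = 1" by (metis int_one_le_iff_zero_less less_le_not_le
            linorder_le_less_linear order_antisym_conv zle_add1_eq_le one_add_one)
      then show "(e, f) \<in> ?T"
      proof cases
        case 1
        have ev: "even (chain_form n e)" "even (e6_form f)" using D 1 even_e6_form by auto
        have "chain_form n e + e6_form f = 2 \<or> chain_form n e + e6_form f = 3" using Q 1 by simp
        \<comment> \<open>Both summands are even and non-negative, so the total is 2 and exactly one
          of them vanishes.\<close>
        then have "chain_form n e = 2 \<and> e6_form f = 0 \<or> chain_form n e = 0 \<and> e6_form f = 2"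
          using ev chain_form_nonneg[of n e] e6_form_nonneg[of f] by presburger
        then show ?thesis
          using chain_form_eq_0[of n e] e f 1
          by (auto simp: inner_chain_iff e6_roots_def e6_form_eq_0_iff simp del: e6_form.simps)
      next
        case 2
        let ?g = "e6_form f - 2 * fst f"
        have par: "odd (chain_form n e)" "even ?g" using D 2 even_e6_form[of f] by auto
        have "chain_form n e + ?g = 0 \<or> chain_form n e + ?g = 1" "0 \<le> 9 * ?g + 12"
          using Q ge 2 by auto
        \<comment> \<open>An even integer that is at least -4/3 is non-negative, while the odd chain
          part is at least 1. Hence these divisors have self-intersection -3.\<close>
        then have "chain_form n e = 1" "?g = 0" using par D(1) 2 by presburger+
        then show ?thesis using e f 2 by (auto simp: initial_chain_iff e6_minuscule_def)
      qed
    next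
      assume "(e, f) \<in> ?T"
      then consider "e \<in> inner_chains n" "f = (0, 0, 0, 0, 0, 0)"
        | "e = (\<lambda>_. 0)" "f \<in> e6_roots" | "e \<in> initial_chains n" "f \<in> e6_minuscule" by blast
      then show "(\<forall>i>n. e i = 0) \<and> (\<forall>i. 0 \<le> e i) \<and> e6_nonneg f \<and> (?Q = 2 \<or> ?Q = 3)"
      proof cases
        case 1
        then show ?thesis by (simp add: inner_chain_iff)
      next
        case 2
        then show ?thesis by (simp add: e6_roots_def chain_form_def)
      next
        case 3
        have "\<forall>i. 0 \<le> e i" using 3(1) by (auto simp: initial_chains_def)
        then show ?thesis using 3 by (simp add: initial_chain_iff e6_minuscule_def)
      qed
    qed
    finally show ?thesis .
  qed
  have ex: "\<exists>x. Y = divisor x" if "Y \<in> positive_triple_roots n" for Y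
  proof -
    have "Y \<in> vertex_lattice (F_tree n)"
      using that by (simp add: positive_triple_roots_def positive_divisor_def)
    then show ?thesis by (rule lattice_divisorE) (rule exI)
  qed
  show ?thesis
  proof (intro subset_antisym subsetI)
    fix Y assume Y: "Y \<in> positive_triple_roots n"
    then obtain e f where "Y = divisor (e, f)" using ex by (metis surj_pair)
    then show "Y \<in> divisor ` ?T" using Y mem by blast
  next
    fix Y assume "Y \<in> divisor ` ?T"
    then obtain x where x: "Y = divisor x" "x \<in> ?T" by (rule imageE)
    then show "Y \<in> positive_triple_roots n" using mem[of "fst x" "snd x"] by (simp only: prod.collapse)
  qed
qed

text \<open>Doubling avoids dividing \<open>n * (n + 1)\<close> by 2; the sum is
  \<open>n * (n + 1) + 72 + 54 * (n + 1)\<close>.\<close>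

lemma card_positive_triple_roots:
  "finite (positive_triple_roots n)" "2 * card (positive_triple_roots n) = n^2 + 55 * n + 126"
proof -
  let ?A = "inner_chains n \<times> {(0, 0, 0, 0, 0, 0) :: e6}"
  let ?B = "{\<lambda>_ :: nat. 0 :: int} \<times> e6_roots"
  let ?C = "initial_chains n \<times> e6_minuscule"
  have fin: "finite ?A" "finite ?B" "finite ?C" by (simp_all add: finite_chains finite_e6)
  then show "finite (positive_triple_roots n)"
    unfolding positive_triple_roots_eq by (intro finite_imageI finite_UnI)
  have "(0, 0, 0, 0, 0, 0) \<notin> e6_roots" by (simp add: e6_roots_def)
  then have AB: "?A \<inter> ?B = {}" by auto
  \<comment> \<open>The coefficient \<open>e 0\<close> separates the families: it is 0 in the first
    two and 1 in the third.\<close>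
  have C: "(?A \<union> ?B) \<inter> ?C = {}" by (auto simp: inner_chain_iff initial_chain_iff)
  have "card (?A \<union> ?B \<union> ?C) = card ?A + card ?B + card ?C"
    using card_Un_disjoint[OF finite_UnI[OF fin(1,2)] fin(3) C]
      card_Un_disjoint[OF fin(1,2) AB] by (simp only:)
  then have "card (positive_triple_roots n) = card (inner_chains n) + 36 + (n + 1) * 27"
    unfolding positive_triple_roots_eq
    by (subst card_image[OF inj_on_subset[OF inj_divisor subset_UNIV]])
      (simp add: card_cartesian_product card_e6_roots card_e6_minuscule card_initial_chains)
  then show "2 * card (positive_triple_roots n) = n^2 + 55 * n + 126"
    using card_inner_chains[of n] by (simp add: power2_eq_square)
qed

theorem proposition3p19:
  fixes n :: nat
  shows "card (triple_root_system (F_tree n)) = n^2 + 55 * n + 126"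
proof -
  let ?P = "positive_triple_roots n" and ?neg = "\<lambda>(Y :: vertex \<Rightarrow> int) v. - Y v"
  have "inj ?neg" by (rule injI) (simp add: fun_eq_iff)
  then have "card (?neg ` ?P) = card ?P" by (meson card_image inj_on_subset subset_UNIV)
  moreover have "?P \<inter> ?neg ` ?P = {}"
  proof -
    have False if "positive_divisor G Y" "positive_divisor G (?neg Y)"
      for G :: "vertex weighted_graph" and Y
    proof -
      have "Y v = 0" for v
        using that by (cases "v \<in> verts G") (force simp: positive_divisor_def vertex_lattice_def)+
      then show False using that(1) by (auto simp: positive_divisor_def)
    qed
    then show ?thesis unfolding positive_triple_roots_def by auto
  qed
  ultimately have "card (triple_root_system (F_tree n)) = 2 * card ?P"
    unfolding triple_root_system_F_tree
    by (subst card_Un_disjoint) (simp_all add: card_positive_triple_roots(1))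
  then show ?thesis by (simp add: card_positive_triple_roots(2))
qed

end
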